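(* Let $\mathcal{X}$ be a Banach space and let $A\in\mathcal{L}(\mathcal{X})$, $A\neq0$, be a Moore-Penrose invertible operator. Suppose that $(A_n)_{n\in\mathbb{N}}\subset\mathcal{L}(\mathcal{X})$ is a sequence of operators such that for each $n\in\mathbb{N}$, $A_n$ is Moore-Penrose invertible. If $(A_n)_{n\in\mathbb{N}}$ converges to $A$, then the following statements are equivalent (limits as $n\to\infty$, operators in the operator norm). (i) $A_n^\dag\to A^\dag$. (ii) $A_n^\dag A_n\to A^\dag A$ and $A_nA_n^\dag\to AA^\dag$. (iii) $A_n^\dag A_n\to A^\dag A$ and $\widehat{\delta}(\mathcal{N}(A_n^\dag),\mathcal{N}(A^\dag))\to0$. (iv) $A_nA_n^\dag\to AA^\dag$ and $\widehat{\delta}(\mathcal{R}(A_n^\dag),\mathcal{R}(A^\dag))\to0$. (v) $\widehat{\delta}(\mathcal{R}(A_n^\dag),\mathcal{R}(A^\dag))\to0$ and $\widehat{\delta}(\mathcal{N}(A_n^\dag),\mathcal{N}(A^\dag))\to0$.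
   Context: $\mathcal{L}(\mathcal{X})$ is the Banach algebra of bounded linear operators on $\mathcal{X}$; $\mathcal{R}(T)$, $\mathcal{N}(T)$ are the range and null space of $T$. An element $z$ of a unital Banach algebra $\mathcal{A}$ is hermitian if $\|\exp(itz)\|=1$ for all $t\in\mathbb{R}$. An element $x\in\mathcal{A}$ is Moore-Penrose invertible if there is $y\in\mathcal{A}$ with $x=xyx$, $y=yxy$ and $xy$, $yx$ hermitian; such $y$ is unique when it exists and is denoted $x^\dag$ (here $\mathcal{A}=\mathcal{L}(\mathcal{X})$). For closed subspaces $\mathcal{M},\mathcal{N}$ of a Banach space, $\delta(\mathcal{M},\mathcal{N})=0$ if $\mathcal{M}=0$, otherwise $\delta(\mathcal{M},\mathcal{N})=\sup\{\mathrm{dist}(x,\mathcal{N}): x\in\mathcal{M},\|x\|=1\}$; the gap is $\widehat{\delta}(\mathcal{M},\mathcal{N})=\max\{\delta(\mathcal{M},\mathcal{N}),\delta(\mathcal{N},\mathcal{M})\}$. *)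

theory Defs
  imports "HOL-Analysis.Analysis"
begin

text \<open>
  The scalars are complex, as \<open>exp (i t z)\<close> in the definition of a hermitian element requires.
  HOL-Analysis only provides real normed spaces, so complex scalar multiplication is added
  on top of \<^class>\<open>banach\<close>.
\<close>

class complex_normed_vector = real_normed_vector +
  fixes scaleC :: "complex \<Rightarrow> 'a \<Rightarrow> 'a"  (infixr \<open>*\<^sub>C\<close> 75)
  assumes scaleC_add_right: "c *\<^sub>C (x + y) = c *\<^sub>C x + c *\<^sub>C y"
    and scaleC_add_left: "(c + d) *\<^sub>C x = c *\<^sub>C x + d *\<^sub>C x"
    and scaleC_scaleC: "c *\<^sub>C (d *\<^sub>C x) = (c * d) *\<^sub>C x"
    and scaleC_of_real: "complex_of_real r *\<^sub>C x = r *\<^sub>R x"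
    and norm_scaleC: "norm (c *\<^sub>C x) = cmod c * norm x"

class complex_banach = complex_normed_vector + banach

text \<open>
  Unital complex Banach algebras. Unlike in \<^class>\<open>real_normed_algebra_1\<close>, the
  zero algebra is admitted, so that the bounded operators on every complex Banach space,
  the zero space included, form an instance.
\<close>

class complex_banach_algebra = complex_banach + real_normed_algebra + monoid_mult +
  assumes scaleC_mult_left: "(c *\<^sub>C x) * y = c *\<^sub>C (x * y)"
    and scaleC_mult_right: "x * (c *\<^sub>C y) = c *\<^sub>C (x * y)"
    and norm_one_unless_zero: "1 \<noteq> 0 \<Longrightarrow> norm 1 = 1"

text \<open>
  This is the defining series of \<^const>\<open>exp\<close>, whose type excludes the zero algebra.
\<close>

definition alg_exp :: "'a::complex_banach_algebra \<Rightarrow> 'a"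
  where "alg_exp x = (\<Sum>n. x ^ n /\<^sub>R fact n)"

lemma alg_exp_eq_exp:
  "alg_exp (x :: 'a::{complex_banach_algebra, real_normed_algebra_1}) = exp x"
  by (simp add: alg_exp_def exp_def)

definition hermitian :: "'a::complex_banach_algebra \<Rightarrow> bool"
  where "hermitian z \<longleftrightarrow> (\<forall>t::real. norm (alg_exp ((\<i> * complex_of_real t) *\<^sub>C z)) = 1)"

definition is_MP_inverse :: "'a::complex_banach_algebra \<Rightarrow> 'a \<Rightarrow> bool"
  where "is_MP_inverse x y \<longleftrightarrow>
    x = x * y * x \<and> y = y * x * y \<and> hermitian (x * y) \<and> hermitian (y * x)"

definition MP_invertible :: "'a::complex_banach_algebra \<Rightarrow> bool"
  where "MP_invertible x \<longleftrightarrow> (\<exists>y. is_MP_inverse x y)"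

definition MP_inverse :: "'a::complex_banach_algebra \<Rightarrow> 'a"  (\<open>(_\<^sup>\<dagger>)\<close> [1000] 999)
  where "x\<^sup>\<dagger> = (THE y. is_MP_inverse x y)"


section \<open>The Banach algebra of bounded complex-linear operators\<close>

typedef (overloaded) 'a operator =
  "{T :: 'a::complex_normed_vector \<Rightarrow>\<^sub>L 'a. \<forall>c x. blinfun_apply T (c *\<^sub>C x) = c *\<^sub>C blinfun_apply T x}"
  morphisms blinfun_of Abs_operator
proof -
  have "(c *\<^sub>C (0::'a)) = 0" for c
    using norm_scaleC[of c "0::'a"] by simp
  then show ?thesis
    by (intro exI[of _ 0]) simp
qed

setup_lifting type_definition_operator

lemma blinfun_of_scaleC: "blinfun_apply (blinfun_of T) (c *\<^sub>C x) = c *\<^sub>C blinfun_apply (blinfun_of T) x"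
  using blinfun_of[of T] by simp

lift_definition op_apply :: "'a::complex_normed_vector operator \<Rightarrow> 'a \<Rightarrow> 'a"
  is blinfun_apply .

lemma scaleC_zero_right [simp]: "c *\<^sub>C (0::'a::complex_normed_vector) = 0"
  using norm_scaleC[of c "0::'a"] by simp

lemma scaleC_minus_right: "c *\<^sub>C (- x) = - (c *\<^sub>C (x::'a::complex_normed_vector))"
  using scaleC_add_right[of c x "- x"] by (simp add: eq_neg_iff_add_eq_0 add.commute)

lemma scaleC_diff_right: "c *\<^sub>C (x - y) = c *\<^sub>C x - c *\<^sub>C (y::'a::complex_normed_vector)"
  using scaleC_add_right[of c x "- y"] by (simp add: scaleC_minus_right)

lemma scaleC_scaleR_commute:
  "c *\<^sub>C (r *\<^sub>R x) = r *\<^sub>R (c *\<^sub>C (x::'a::complex_normed_vector))"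
  by (simp add: scaleC_of_real[symmetric] scaleC_scaleC mult.commute)

lemma scaleC_one [simp]: "1 *\<^sub>C (x::'a::complex_normed_vector) = x"
  using scaleC_of_real[of 1 x] by simp

lemma bounded_linear_scaleC: "bounded_linear (\<lambda>x::'a::complex_normed_vector. c *\<^sub>C x)"
  by (rule bounded_linear_intro[of _ "cmod c"])
    (simp_all add: scaleC_add_right scaleC_scaleR_commute norm_scaleC mult.commute)

lift_definition blinfun_scaleC ::
  "complex \<Rightarrow> ('a::real_normed_vector \<Rightarrow>\<^sub>L 'b::complex_normed_vector) \<Rightarrow> 'a \<Rightarrow>\<^sub>L 'b"
  is "\<lambda>c T x. c *\<^sub>C T x"
  by (rule bounded_linear_compose[OF bounded_linear_scaleC])

lemma norm_blinfun_scaleC: "norm (blinfun_scaleC c T) = cmod c * norm T"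
proof (rule antisym)
  have le: "norm (blinfun_scaleC d S) \<le> cmod d * norm S" for d and S :: "'a \<Rightarrow>\<^sub>L 'b"
    by (rule norm_blinfun_bound)
      (auto simp: blinfun_scaleC.rep_eq norm_scaleC mult.assoc
        intro!: mult_left_mono norm_blinfun)
  show "norm (blinfun_scaleC c T) \<le> cmod c * norm T" by (rule le)
  show "cmod c * norm T \<le> norm (blinfun_scaleC c T)"
  proof (cases "c = 0")
    case False
    have "blinfun_scaleC (inverse c) (blinfun_scaleC c T) = T"
      using False by (intro blinfun_eqI) (simp add: blinfun_scaleC.rep_eq scaleC_scaleC)
    then have "norm T \<le> cmod (inverse c) * norm (blinfun_scaleC c T)"
      using le[of "inverse c" "blinfun_scaleC c T"] by simp
    then have "cmod c * norm T \<le> cmod c * (cmod (inverse c) * norm (blinfun_scaleC c T))"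
      by (intro mult_left_mono) auto
    then show ?thesis using False by (simp add: norm_inverse mult.assoc[symmetric])
  qed simp
qed

instantiation operator :: (complex_normed_vector) complex_normed_vector
begin

lift_definition zero_operator :: "'a operator" is 0 by simp
lift_definition plus_operator :: "'a operator \<Rightarrow> 'a operator \<Rightarrow> 'a operator" is "(+)"
  by (simp add: blinfun.add_left scaleC_add_right)
lift_definition minus_operator :: "'a operator \<Rightarrow> 'a operator \<Rightarrow> 'a operator" is "(-)"
  by (simp add: blinfun.diff_left scaleC_diff_right)
lift_definition uminus_operator :: "'a operator \<Rightarrow> 'a operator" is uminus
  by (simp add: blinfun.minus_left scaleC_minus_right)
lift_definition scaleR_operator :: "real \<Rightarrow> 'a operator \<Rightarrow> 'a operator" is "(*\<^sub>R)"
  by (simp add: blinfun.scaleR_left scaleC_scaleR_commute)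
lift_definition scaleC_operator :: "complex \<Rightarrow> 'a operator \<Rightarrow> 'a operator" is blinfun_scaleC
  by (simp add: blinfun_scaleC.rep_eq scaleC_scaleC mult.commute)
lift_definition norm_operator :: "'a operator \<Rightarrow> real" is norm .
lift_definition dist_operator :: "'a operator \<Rightarrow> 'a operator \<Rightarrow> real" is dist .
definition sgn_operator :: "'a operator \<Rightarrow> 'a operator"
  where "sgn_operator T = inverse (norm T) *\<^sub>R T"
definition uniformity_operator :: "('a operator \<times> 'a operator) filter"
  where "uniformity_operator = (INF e\<in>{0<..}. principal {(S, T). dist S T < e})"
definition open_operator :: "'a operator set \<Rightarrow> bool"
  where "open_operator U = (\<forall>S\<in>U. \<forall>\<^sub>F (S', T) in uniformity. S' = S \<longrightarrow> T \<in> U)"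

instance
proof
  fix S T R :: "'a operator" and r s :: real and c d :: complex
  show "S + T + R = S + (T + R)" "S + T = T + S" "0 + S = S" "- S + S = 0" "S - T = S + - T"
    by (transfer; simp)+
  show "r *\<^sub>R (S + T) = r *\<^sub>R S + r *\<^sub>R T" "(r + s) *\<^sub>R S = r *\<^sub>R S + s *\<^sub>R S"
    "r *\<^sub>R s *\<^sub>R S = (r * s) *\<^sub>R S" "1 *\<^sub>R S = S"
    by (transfer; simp add: scaleR_add_right scaleR_add_left)+
  show "dist S T = norm (S - T)" by transfer (rule dist_norm)
  show "sgn S = inverse (norm S) *\<^sub>R S" by (rule sgn_operator_def)
  show "(uniformity :: ('a operator \<times> 'a operator) filter) =
      (INF e\<in>{0<..}. principal {(S, T). dist S T < e})"
    by (rule uniformity_operator_def)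
  show "open U = (\<forall>S\<in>U. \<forall>\<^sub>F (S', T) in uniformity. S' = S \<longrightarrow> T \<in> U)"
    for U :: "'a operator set"
    by (rule open_operator_def)
  show "(norm S = 0) = (S = 0)" by transfer simp
  show "norm (S + T) \<le> norm S + norm T" by transfer (rule norm_triangle_ineq)
  show "norm (r *\<^sub>R S) = \<bar>r\<bar> * norm S" by transfer simp
  show "c *\<^sub>C (S + T) = c *\<^sub>C S + c *\<^sub>C T" "(c + d) *\<^sub>C S = c *\<^sub>C S + d *\<^sub>C S"
    "c *\<^sub>C d *\<^sub>C S = (c * d) *\<^sub>C S" "complex_of_real r *\<^sub>C S = r *\<^sub>R S"
    by (transfer; intro blinfun_eqI; simp add: blinfun_scaleC.rep_eq blinfun.add_left
        blinfun.scaleR_left scaleC_add_right scaleC_add_left scaleC_scaleC scaleC_of_real)+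
  show "norm (c *\<^sub>C S) = cmod c * norm S" by transfer (rule norm_blinfun_scaleC)
qed

end

instance operator :: (complex_banach) complex_banach
proof
  fix X :: "nat \<Rightarrow> 'a operator"
  assume "Cauchy X"
  then have "Cauchy (\<lambda>n. blinfun_of (X n))"
    by (simp add: Cauchy_def dist_operator.rep_eq)
  then obtain L where L: "(\<lambda>n. blinfun_of (X n)) \<longlonglongrightarrow> L"
    using Cauchy_convergent_iff convergent_def by metis
  have pt: "(\<lambda>n. blinfun_of (X n) x) \<longlonglongrightarrow> L x" for x
    using L by (intro tendsto_intros)
  have "blinfun_apply L (c *\<^sub>C x) = c *\<^sub>C blinfun_apply L x" for c x
  proof (rule LIMSEQ_unique)
    show "(\<lambda>n. blinfun_of (X n) (c *\<^sub>C x)) \<longlonglongrightarrow> L (c *\<^sub>C x)" by (rule pt)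
    have "(\<lambda>n. c *\<^sub>C blinfun_of (X n) x) \<longlonglongrightarrow> c *\<^sub>C L x"
      by (rule bounded_linear.tendsto[OF bounded_linear_scaleC pt])
    then show "(\<lambda>n. blinfun_of (X n) (c *\<^sub>C x)) \<longlonglongrightarrow> c *\<^sub>C L x"
      by (simp add: blinfun_of_scaleC)
  qed
  then have "blinfun_of (Abs_operator L) = L"
    by (simp add: Abs_operator_inverse)
  then have "X \<longlonglongrightarrow> Abs_operator L"
    using L by (simp add: tendsto_iff dist_operator.rep_eq)
  then show "convergent X" by (auto simp: convergent_def)
qed

instantiation operator :: (complex_banach) complex_banach_algebra
begin

lift_definition one_operator :: "'a operator" is id_blinfun by simp
lift_definition times_operator :: "'a operator \<Rightarrow> 'a operator \<Rightarrow> 'a operator" is "(o\<^sub>L)"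
  by simp

instance
proof
  fix S T R :: "'a operator" and r :: real and c :: complex
  show "S * T * R = S * (T * R)" "1 * S = S" "S * 1 = S"
    by (transfer; intro blinfun_eqI; simp)+
  show "(S + T) * R = S * R + T * R" "R * (S + T) = R * S + R * T"
    "(r *\<^sub>R S) * T = r *\<^sub>R (S * T)" "S * (r *\<^sub>R T) = r *\<^sub>R (S * T)"
    by (transfer; intro blinfun_eqI; simp add: blinfun.bilinear_simps)+
  show "(c *\<^sub>C S) * T = c *\<^sub>C (S * T)" "S * (c *\<^sub>C T) = c *\<^sub>C (S * T)"
    by (transfer; intro blinfun_eqI; simp add: blinfun_scaleC.rep_eq)+
  show "norm (S * T) \<le> norm S * norm T" by transfer (rule norm_blinfun_compose)
  show "norm (1 :: 'a operator) = 1" if "(1 :: 'a operator) \<noteq> 0"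
    using that
  proof transfer
    assume "(id_blinfun :: 'a \<Rightarrow>\<^sub>L 'a) \<noteq> 0"
    then obtain x :: 'a where x: "x \<noteq> 0"
      by (metis blinfun_eqI id_blinfun.rep_eq zero_blinfun.rep_eq)
    have "norm x \<le> norm (id_blinfun :: 'a \<Rightarrow>\<^sub>L 'a) * norm x"
      using norm_blinfun[of id_blinfun x] by simp
    with x have "1 \<le> norm (id_blinfun :: 'a \<Rightarrow>\<^sub>L 'a)" by simp
    moreover have "norm (id_blinfun :: 'a \<Rightarrow>\<^sub>L 'a) \<le> 1"
      by (rule norm_blinfun_bound) auto
    ultimately show "norm (id_blinfun :: 'a \<Rightarrow>\<^sub>L 'a) = 1" by simp
  qed
qed

end

lemma op_apply_mult: "op_apply (S * T) x = op_apply S (op_apply T x)"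
  by transfer simp

definition op_range :: "'a::complex_normed_vector operator \<Rightarrow> 'a set"
  where "op_range T = range (op_apply T)"

definition op_null :: "'a::complex_normed_vector operator \<Rightarrow> 'a set"
  where "op_null T = {x. op_apply T x = 0}"


section \<open>The gap between closed subspaces\<close>

text \<open>
  These are meant for closed subspaces \<open>M\<close> and \<open>N\<close>. For those, the set whose supremum is taken
  is nonempty unless \<open>M = {0}\<close>, and it is bounded above by \<open>1\<close> since \<open>0 \<in> N\<close>.
\<close>

definition gap_delta :: "'a::real_normed_vector set \<Rightarrow> 'a set \<Rightarrow> real"
  where "gap_delta M N =
    (if M = {0} then 0 else SUP x\<in>{x\<in>M. norm x = 1}. infdist x N)"

definition gap :: "'a::real_normed_vector set \<Rightarrow> 'a set \<Rightarrow> real"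
  where "gap M N = max (gap_delta M N) (gap_delta N M)"

end

theory Submission
  imports Defs
begin

text \<open>
  For a hermitian idempotent \<open>p\<close>, \<open>exp (i \<pi> p) = 1 - 2 p\<close>, so \<open>1 - 2 p\<close> is a contraction. If \<open>p\<close> and
  \<open>q\<close> are two such idempotents whose ranges almost coincide, then \<open>h = p - q\<close> satisfies \<open>h\<^sup>2 \<approx> 0\<close> and
  \<open>(1 - 2 p) (1 - 2 q) \<approx> 1 - 2 h\<close>; the \<open>N\<close>-th power of this contraction is about \<open>1 - 2 N h\<close>, which
  forces \<open>\<parallel>h\<parallel>\<close> to be at most about \<open>1 / N\<close>. Hence hermitian idempotents converge as soon as their
  ranges, or their null spaces, converge in the gap. Since \<open>x\<^sup>\<dagger> x\<close> has the range and \<open>x x\<^sup>\<dagger>\<close> the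
  null space of \<open>x\<^sup>\<dagger>\<close>, all conditions reduce to (ii), and (ii) yields (i) through the identity
  \<open>b' - b = b' (a - a') b + b' (a' b' - a b) - (b a - b' a') b\<close> for \<open>b = a\<^sup>\<dagger>\<close>, \<open>b' = a'\<^sup>\<dagger>\<close>.
\<close>

section \<open>Hermitian idempotents and their reflections\<close>

text \<open>For \<open>n > 0\<close> the powers \<open>(c p)^n\<close> equal \<open>c^n p\<close>.
  So the series differs from \<open>exp c\<close> times \<open>p\<close> only at
  \<open>n = 0\<close>, where \<open>1\<close> stands in place of \<open>p\<close>; this contributes
  the summand \<open>1 - p\<close>.\<close>

lemma alg_exp_scaleC_idempotent:
  fixes p :: "'a::complex_banach_algebra"
  assumes "p * p = p"
  shows "alg_exp (c *\<^sub>C p) = (1 - p) + exp c *\<^sub>C p"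
proof -
  have pow: "(c *\<^sub>C p) ^ Suc n = c ^ Suc n *\<^sub>C p" for n
  proof (induction n)
    case (Suc n)
    show ?case
      unfolding power_Suc[of _ "Suc n"] Suc.IH
      by (simp add: scaleC_mult_left scaleC_mult_right scaleC_scaleC assms mult_ac)
  qed simp
  have lin: "bounded_linear (\<lambda>d. d *\<^sub>C p)"
    by (rule bounded_linear_intro[of _ "norm p"])
      (simp_all add: scaleC_add_left norm_scaleC scaleR_conv_of_real scaleC_scaleC[symmetric] scaleC_of_real)
  have "(\<lambda>n. (if n = 0 then 1 - p else 0) + (c ^ n /\<^sub>R fact n) *\<^sub>C p) sums ((1 - p) + exp c *\<^sub>C p)"
    using sums_single[of 0 "\<lambda>_. 1 - p"] bounded_linear.sums[OF lin exp_converges[of c]]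
    by (intro sums_add) auto
  moreover have "(if n = 0 then 1 - p else 0) + (c ^ n /\<^sub>R fact n) *\<^sub>C p = (c *\<^sub>C p) ^ n /\<^sub>R fact n" for n
  proof (cases n)
    case (Suc m)
    have "(r *\<^sub>R d) *\<^sub>C p = r *\<^sub>R (d *\<^sub>C p)" for d and r :: real
      by (rule linear_cmul[OF bounded_linear.linear[OF lin]])
    then show ?thesis using Suc pow[of m] by simp
  qed simp
  ultimately show ?thesis
    by (simp add: alg_exp_def sums_iff)
qed

text \<open>The element \<open>1 - 2 p\<close> is the reflection \<open>exp (i \<pi> p)\<close>.
  This bound is all that the later estimates retain from hermiticity, and it involves real scalars
  only.\<close>

definition contractive_reflection :: "'a::{real_normed_algebra, monoid_mult} \<Rightarrow> bool"
  where "contractive_reflection p \<longleftrightarrow> p * p = p \<and> norm (1 - 2 *\<^sub>R p) \<le> 1"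

text \<open>Take \<open>t = \<pi>\<close>: since \<open>exp (i \<pi>) = -1\<close>, the exponential
  becomes \<open>1 - 2 p\<close>.\<close>

lemma hermitian_idempotent_contractive_reflection:
  fixes p :: "'a::complex_banach_algebra"
  assumes "hermitian p" "p * p = p"
  shows "contractive_reflection p"
proof -
  have "norm (alg_exp ((\<i> * complex_of_real pi) *\<^sub>C p)) = 1"
    using assms(1) by (simp add: hermitian_def)
  moreover have "(- 1) *\<^sub>C p = - p"
    using scaleC_of_real[of "- 1" p] by simp
  ultimately have "norm ((1 - p) + - p) = 1"
    by (simp add: alg_exp_scaleC_idempotent[OF assms(2)])
  then show ?thesis
    by (simp add: contractive_reflection_def assms(2) scaleR_2 algebra_simps)
qed

context
  fixes p :: "'a::{real_normed_algebra, monoid_mult}"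
  assumes p: "contractive_reflection p"
begin

lemma contractive_reflection_idem: "p * p = p"
  using p by (simp add: contractive_reflection_def)

text \<open>Passing to the complement only changes the sign of the reflection. This lets null spaces
  be treated as ranges.\<close>

lemma contractive_reflection_complement: "contractive_reflection (1 - p)"
proof -
  have "1 - 2 *\<^sub>R (1 - p) = - (1 - 2 *\<^sub>R p)"
    by (simp add: scaleR_2 algebra_simps)
  then have "norm (1 - 2 *\<^sub>R (1 - p)) = norm (1 - 2 *\<^sub>R p)"
    by (simp only: norm_minus_cancel)
  then show ?thesis
    using p by (simp add: contractive_reflection_def algebra_simps)
qed

text \<open>A reflection squares to \<open>1\<close>. The sort by itself leaves
  \<open>norm 1\<close> open, so the bound is drawn from \<open>p\<close>.\<close>

lemma norm_one_le_of_contractive_reflection: "norm (1::'a) \<le> 1"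
proof -
  have "(1::'a) = (1 - 2 *\<^sub>R p) * (1 - 2 *\<^sub>R p)"
    by (simp add: algebra_simps contractive_reflection_idem scaleR_2)
  then have "norm (1::'a) \<le> norm (1 - 2 *\<^sub>R p) * norm (1 - 2 *\<^sub>R p)"
    by (metis norm_mult_ineq)
  also have "\<dots> \<le> 1"
    using p by (simp add: contractive_reflection_def mult_le_one)
  finally show ?thesis .
qed

lemma norm_contractive_reflection_le: "norm p \<le> 1"
proof -
  have "2 *\<^sub>R p = 1 - (1 - 2 *\<^sub>R p)"
    by simp
  then have "norm (2 *\<^sub>R p) \<le> norm (1::'a) + norm (1 - 2 *\<^sub>R p)"
    by (metis norm_triangle_ineq4)
  then show ?thesis
    using p norm_one_le_of_contractive_reflection by (simp add: contractive_reflection_def)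
qed

end

section \<open>Quantitative comparison of two idempotents\<close>

text \<open>If \<open>h * h\<close> and \<open>e\<close> vanished, the powers would be exactly
  \<open>1 - 2 N h\<close>. In general, multiplying by the contraction does not enlarge the error
  made so far, and step \<open>N\<close> adds at most \<open>1 + 4 N\<close> times
  \<open>norm (h * h) + norm e\<close>.\<close>

lemma norm_power_near_unipotent:
  fixes h e :: "'a::{real_normed_algebra, monoid_mult}"
  assumes one: "norm (1::'a) \<le> 1" and h: "norm h \<le> 2" and u: "norm (1 - 2 *\<^sub>R h + e) \<le> 1"
  shows "norm ((1 - 2 *\<^sub>R h + e) ^ N - (1 - (2 * real N) *\<^sub>R h))
    \<le> real N * (1 + 4 * real N) * (norm (h * h) + norm e)"
proof (induction N)
  case (Suc N)
  let ?u = "1 - 2 *\<^sub>R h + e" and ?\<epsilon> = "norm (h * h) + norm e"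
  let ?d = "?u ^ N - (1 - (2 * real N) *\<^sub>R h)"
  let ?b = "(4 * real N) *\<^sub>R (h * h) + e * (1 - (2 * real N) *\<^sub>R h)"
  \<comment> \<open>\<open>?u * ?d\<close> carries the old error along; \<open>?b\<close> is the new
    one, the failure of \<open>?u * (1 - 2 N h)\<close> to equal
    \<open>1 - 2 (N + 1) h\<close>.\<close>
  have "?u ^ Suc N - (1 - (2 * real (Suc N)) *\<^sub>R h) = ?u * ?d + ?b"
    by (simp add: algebra_simps)
  moreover have "norm (?u * ?d) \<le> real N * (1 + 4 * real N) * ?\<epsilon>"
    using mult_mono[OF u Suc.IH] norm_mult_ineq[of ?u ?d] by simp
  moreover have "norm ?b \<le> (1 + 4 * real N) * ?\<epsilon>"
  proof -
    have "norm (1 - (2 * real N) *\<^sub>R h) \<le> norm (1::'a) + norm ((2 * real N) *\<^sub>R h)"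
      by (rule norm_triangle_ineq4)
    also have "\<dots> \<le> 1 + 4 * real N"
      using one mult_left_mono[OF h, of "2 * real N"] by simp
    finally have "norm (e * (1 - (2 * real N) *\<^sub>R h)) \<le> norm e * (1 + 4 * real N)"
      by (meson mult_left_mono norm_ge_zero norm_mult_ineq order_trans)
    then have "norm ?b \<le> (4 * real N) * norm (h * h) + norm e * (1 + 4 * real N)"
      using norm_triangle_ineq[of "(4 * real N) *\<^sub>R (h * h)" "e * (1 - (2 * real N) *\<^sub>R h)"] by simp
    also have "\<dots> \<le> (1 + 4 * real N) * ?\<epsilon>"
      by (simp add: algebra_simps)
    finally show ?thesis .
  qed
  ultimately have "norm (?u ^ Suc N - (1 - (2 * real (Suc N)) *\<^sub>R h))
      \<le> real (Suc N) * (1 + 4 * real N) * ?\<epsilon>"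
    using norm_triangle_ineq[of "?u * ?d" ?b] by (simp add: algebra_simps)
  also have "\<dots> \<le> real (Suc N) * (1 + 4 * real (Suc N)) * ?\<epsilon>"
    by (intro mult_right_mono mult_left_mono) auto
  finally show ?case .
qed simp

lemma norm_power_le_one:
  fixes u :: "'a::{real_normed_algebra, monoid_mult}"
  assumes "norm (1::'a) \<le> 1" "norm u \<le> 1"
  shows "norm (u ^ N) \<le> 1"
proof (induction N)
  case (Suc N)
  have "norm (u ^ Suc N) \<le> norm u * norm (u ^ N)"
    by (simp add: norm_mult_ineq)
  also have "\<dots> \<le> 1"
    using assms Suc by (simp add: mult_le_one)
  finally show ?case .
qed (use assms in simp)

text \<open>The product of the two reflections is a contraction \<open>1 - 2 h + e\<close> with
  \<open>h = p - q\<close>. Its \<open>N\<close>-th power has norm at most one and is close to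
  \<open>1 - 2 N h\<close>, so \<open>2 N h\<close> has norm at most \<open>2\<close> plus the
  error. Dividing by \<open>2 N\<close> gives the bound.\<close>

lemma norm_diff_contractive_reflection_le:
  fixes p q :: "'a::{real_normed_algebra, monoid_mult}"
  assumes p: "contractive_reflection p" and q: "contractive_reflection q"
  shows "norm (p - q) \<le>
    1 / real (Suc k) + (1 + 4 * real (Suc k)) / 2 * (norm (p - q * p) + 5 * norm (q - p * q))"
proof -
  define h where "h = p - q"
  define e where "e = 4 *\<^sub>R (p * q - q)"
  define N where "N = Suc k"
  define \<epsilon> where "\<epsilon> = norm (p - q * p) + 5 * norm (q - p * q)"
  let ?u = "1 - 2 *\<^sub>R h + e"
  note one = norm_one_le_of_contractive_reflection[OF p]
  have hh: "h * h = (p - q * p) + (q - p * q)"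
    by (simp add: h_def algebra_simps contractive_reflection_idem[OF p] contractive_reflection_idem[OF q])
  have u_eq: "?u = (1 - 2 *\<^sub>R p) * (1 - 2 *\<^sub>R q)"
  proof -
    have "4 *\<^sub>R q = 2 *\<^sub>R q + 2 *\<^sub>R q"
      by (simp add: scaleR_add_left[symmetric])
    then show ?thesis by (simp add: h_def e_def algebra_simps)
  qed
  have u: "norm ?u \<le> 1"
    unfolding u_eq using p q
    by (intro order_trans[OF norm_mult_ineq] mult_le_one) (auto simp: contractive_reflection_def)
  have h: "norm h \<le> 2"
    using norm_triangle_ineq4[of p q] norm_contractive_reflection_le[OF p]
      norm_contractive_reflection_le[OF q]
    by (simp add: h_def)
  \<comment> \<open>The factor \<open>5\<close> in \<open>\<epsilon>\<close> collects one copy of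
    \<open>norm (q - p * q)\<close> from \<open>h * h\<close> and four from
    \<open>e\<close>.\<close>
  have "norm (h * h) + norm e \<le> \<epsilon>"
    using norm_triangle_ineq[of "p - q * p" "q - p * q"]
    by (simp add: hh e_def \<epsilon>_def norm_minus_commute)
  then have "real N * (1 + 4 * real N) * (norm (h * h) + norm e) \<le> real N * (1 + 4 * real N) * \<epsilon>"
    by (intro mult_left_mono) auto
  with norm_power_near_unipotent[OF one h u, of N]
  have d: "norm (?u ^ N - (1 - (2 * real N) *\<^sub>R h)) \<le> real N * (1 + 4 * real N) * \<epsilon>"
    by linarith
  let ?d = "?u ^ N - (1 - (2 * real N) *\<^sub>R h)"
  have "(2 * real N) *\<^sub>R h = ?d + (1 - ?u ^ N)"
    by simp
  then have "norm ((2 * real N) *\<^sub>R h) \<le> norm ?d + (norm (1::'a) + norm (?u ^ N))"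
    using norm_triangle_ineq[of ?d "1 - ?u ^ N"] norm_triangle_ineq4[of 1 "?u ^ N"] by simp
  also have "\<dots> \<le> real N * (1 + 4 * real N) * \<epsilon> + 1 + 1"
    using d one norm_power_le_one[OF one u, of N] by linarith
  also have "\<dots> = 2 * real N * (1 / real N + (1 + 4 * real N) / 2 * \<epsilon>)"
    by (simp add: N_def field_simps)
  finally have "2 * real N * norm h \<le> 2 * real N * (1 / real N + (1 + 4 * real N) / 2 * \<epsilon>)"
    by simp
  then have "norm h \<le> 1 / real N + (1 + 4 * real N) / 2 * \<epsilon>"
    by (rule mult_left_le_imp_le) (simp add: N_def)
  then show ?thesis
    by (simp only: h_def N_def \<epsilon>_def)
qed

lemma contractive_reflection_LIMSEQ:
  fixes p :: "nat \<Rightarrow> 'a::{real_normed_algebra, monoid_mult}"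
  assumes p: "\<And>n. contractive_reflection (p n)" and q: "contractive_reflection q"
    and 1: "(\<lambda>n. p n - q * p n) \<longlonglongrightarrow> 0" and 2: "(\<lambda>n. q - p n * q) \<longlonglongrightarrow> 0"
  shows "p \<longlonglongrightarrow> q"
proof -
  have "\<forall>\<^sub>F n in sequentially. norm (p n - q) < r" if "r > 0" for r
  proof -
    \<comment> \<open>\<open>k\<close> is fixed before \<open>n\<close> grows: the first term of the
      bound is then below \<open>r\<close>, and the second, whose factor depends on
      \<open>k\<close>, tends to \<open>0\<close>.\<close>
    obtain k where k: "1 / real (Suc k) < r"
      using reals_Archimedean[OF \<open>r > 0\<close>] unfolding inverse_eq_divide by blast
    have "(\<lambda>n. 1 / real (Suc k) + (1 + 4 * real (Suc k)) / 2 *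
        (norm (p n - q * p n) + 5 * norm (q - p n * q))) \<longlonglongrightarrow>
        1 / real (Suc k) + (1 + 4 * real (Suc k)) / 2 * (0 + 5 * 0)"
      by (intro tendsto_intros tendsto_norm_zero 1 2)
    then have "\<forall>\<^sub>F n in sequentially. 1 / real (Suc k) + (1 + 4 * real (Suc k)) / 2 *
        (norm (p n - q * p n) + 5 * norm (q - p n * q)) < r"
      using k by (intro order_tendstoD(2)) simp_all
    then show ?thesis
      by eventually_elim (use norm_diff_contractive_reflection_le[OF p q] in \<open>rule le_less_trans\<close>)
  qed
  then show ?thesis
    by (simp add: tendsto_iff dist_norm)
qed

text \<open>The two equations say that \<open>p\<close> and \<open>q\<close> have the same range;
  the limit criterion is applied to a constant sequence.\<close>

lemma contractive_reflection_eqI: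
  assumes "contractive_reflection p" "contractive_reflection q" "q * p = p" "p * q = q"
  shows "p = q"
  using contractive_reflection_LIMSEQ[of "\<lambda>_. p" q] assms by (simp add: LIMSEQ_const_iff)

section \<open>Uniqueness of the Moore-Penrose inverse\<close>

lemma is_MP_inverse_contractive_reflection:
  assumes "is_MP_inverse x y"
  shows "contractive_reflection (x * y)" "contractive_reflection (y * x)"
  using assms
  by (auto simp: is_MP_inverse_def mult.assoc[symmetric]
      intro!: hermitian_idempotent_contractive_reflection)

text \<open>Once \<open>x * y = x * z\<close> and \<open>y * x = z * x\<close> are known,
  \<open>y = y * x * y = y * x * z = z * x * z = z\<close>.\<close>

lemma is_MP_inverse_unique:
  assumes y: "is_MP_inverse x y" and z: "is_MP_inverse x z"
  shows "y = z"
proof -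
  have xyx: "x * y * x = x" and yxy: "y * x * y = y" and xzx: "x * z * x = x" and zxz: "z * x * z = z"
    using y z by (simp_all add: is_MP_inverse_def)
  have "x * y = x * z"
    by (rule contractive_reflection_eqI)
      (simp_all add: is_MP_inverse_contractive_reflection y z mult.assoc[symmetric] xyx xzx)
  \<comment> \<open>\<open>y * x\<close> and \<open>z * x\<close> share their null space rather than
    visibly their range, hence the passage to complements.\<close>
  moreover have "1 - y * x = 1 - z * x"
  proof (rule contractive_reflection_eqI)
    have "y * x * (z * x) = y * x" "z * x * (y * x) = z * x"
      using xyx xzx by (simp_all add: mult.assoc)
    then show "(1 - z * x) * (1 - y * x) = 1 - y * x" "(1 - y * x) * (1 - z * x) = 1 - z * x"
      by (simp_all add: algebra_simps)
  qed (intro contractive_reflection_complement is_MP_inverse_contractive_reflection y z)+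
  ultimately show ?thesis
    using yxy zxz by (metis diff_left_imp_eq mult.assoc)
qed

lemma MP_invertible_is_MP_inverse: "MP_invertible x \<Longrightarrow> is_MP_inverse x (x\<^sup>\<dagger>)"
  unfolding MP_invertible_def MP_inverse_def
  by (metis is_MP_inverse_unique theI)

section \<open>Ranges of idempotent operators and the gap\<close>

lemma bounded_linear_op_apply: "bounded_linear (op_apply T)"
  by transfer (rule blinfun.bounded_linear_right)

lemma norm_op_apply_le: "norm (op_apply T x) \<le> norm T * norm x"
  by transfer (rule norm_blinfun)

lemma norm_operator_le:
  assumes "0 \<le> b" "\<And>x. norm (op_apply T x) \<le> b * norm x"
  shows "norm T \<le> b"
  using assms by transfer (rule norm_blinfun_bound)

lemma op_apply_one [simp]: "op_apply 1 x = x"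
  by transfer simp

lemma op_apply_minus: "op_apply (S - T) x = op_apply S x - op_apply T x"
  by transfer (simp add: blinfun.diff_left)

lemma subspace_op_range: "subspace (op_range T)"
  unfolding op_range_def
  by (rule linear_subspace_image[OF bounded_linear.linear[OF bounded_linear_op_apply] subspace_UNIV])

lemma op_range_idempotent:
  assumes "P * P = P"
  shows "x \<in> op_range P \<longleftrightarrow> op_apply P x = x"
  using assms by (metis op_apply_mult op_range_def rangeE rangeI)

text \<open>A nonzero subspace contains a unit vector, so the supremum is over a nonempty set and
  may be bounded termwise.\<close>

lemma gap_delta_le:
  assumes "subspace M" "0 \<le> b" "\<And>x. x \<in> M \<Longrightarrow> norm x = 1 \<Longrightarrow> infdist x N \<le> b"
  shows "gap_delta M N \<le> b"
proof (cases "M = {0}")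
  case False
  then obtain x where "x \<in> M" "x \<noteq> 0"
    using subspace_0[OF assms(1)] by auto
  then have "x /\<^sub>R norm x \<in> {x\<in>M. norm x = 1}"
    using assms(1) by (simp add: subspace_scale)
  then have "{x\<in>M. norm x = 1} \<noteq> {}"
    by blast
  then have "(SUP x\<in>{x\<in>M. norm x = 1}. infdist x N) \<le> b"
    using assms(3) by (intro cSUP_least) auto
  then show ?thesis
    using False by (simp add: gap_delta_def)
qed (use assms in \<open>simp add: gap_delta_def\<close>)

lemma infdist_le_gap_delta:
  assumes "subspace M" "subspace N" "x \<in> M" "norm x = 1"
  shows "infdist x N \<le> gap_delta M N"
proof -
  \<comment> \<open>Comparing with \<open>0 \<in> N\<close> bounds the set of distances above, so
    that its supremum dominates each member.\<close>
  have "infdist y N \<le> 1" if "norm y = 1" for y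
    using infdist_le[OF subspace_0[OF assms(2)], of y] that by simp
  then have "bdd_above ((\<lambda>x. infdist x N) ` {x\<in>M. norm x = 1})"
    by (intro bdd_aboveI2[of _ _ 1]) auto
  then have "infdist x N \<le> (SUP x\<in>{x\<in>M. norm x = 1}. infdist x N)"
    using assms by (intro cSUP_upper) auto
  moreover have "M \<noteq> {0}"
    using assms by auto
  ultimately show ?thesis
    by (simp add: gap_delta_def)
qed

lemma gap_delta_nonneg:
  assumes "subspace M" "subspace N"
  shows "0 \<le> gap_delta M N"
proof (cases "M = {0}")
  case False
  then obtain x where "x \<in> M" "x \<noteq> 0"
    using subspace_0[OF assms(1)] by auto
  then have "infdist (x /\<^sub>R norm x) N \<le> gap_delta M N"
    using assms by (intro infdist_le_gap_delta) (auto simp: subspace_scale)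
  then show ?thesis
    using infdist_nonneg order_trans by blast
qed (simp add: gap_delta_def)

text \<open>For \<open>x\<close> in the range of \<open>P\<close>, the point \<open>Q x\<close> lies
  in the range of \<open>Q\<close> and differs from \<open>x = P x\<close> by
  \<open>(P - Q) x\<close>.\<close>

lemma gap_delta_op_range_le:
  assumes "P * P = P"
  shows "gap_delta (op_range P) (op_range Q) \<le> norm (P - Q)"
proof (rule gap_delta_le[OF subspace_op_range norm_ge_zero])
  fix x assume x: "x \<in> op_range P" "norm x = 1"
  have "infdist x (op_range Q) \<le> dist x (op_apply Q x)"
    by (rule infdist_le) (simp add: op_range_def)
  also have "\<dots> = norm (op_apply (P - Q) x)"
    using x assms by (simp add: op_range_idempotent dist_norm op_apply_minus)
  also have "\<dots> \<le> norm (P - Q)"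
    using norm_op_apply_le[of "P - Q" x] x by simp
  finally show "infdist x (op_range Q) \<le> norm (P - Q)" .
qed

text \<open>The contraction \<open>1 - Q\<close> annihilates the range of \<open>Q\<close>, so
  \<open>y - Q y = (1 - Q) (y - z)\<close> for every \<open>z\<close> there. Thus \<open>Q y\<close>
  is a nearest point to \<open>y\<close>, and \<open>norm P \<le> 1\<close> carries the estimate
  from \<open>y = P x\<close> over to \<open>x\<close>.\<close>

lemma norm_diff_mult_le_gap_delta:
  fixes P Q :: "'a::complex_banach operator"
  assumes P: "contractive_reflection P" and Q: "contractive_reflection Q"
  shows "norm (P - Q * P) \<le> gap_delta (op_range P) (op_range Q)"
    (is "_ \<le> ?\<delta>")
proof -
  interpret Q: bounded_linear "op_apply Q" by (rule bounded_linear_op_apply)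
  have \<delta>: "0 \<le> ?\<delta>"
    by (intro gap_delta_nonneg subspace_op_range)
  have unit: "norm (y - op_apply Q y) \<le> ?\<delta>" if y: "y \<in> op_range P" "norm y = 1" for y
  proof -
    have "norm (y - op_apply Q y) \<le> dist y z" if "z \<in> op_range Q" for z
    proof -
      have "op_apply Q z = z"
        using that op_range_idempotent[OF contractive_reflection_idem[OF Q]] by simp
      then have "norm (y - op_apply Q y) = norm (op_apply (1 - Q) (y - z))"
        by (simp add: op_apply_minus Q.diff)
      also have "\<dots> \<le> norm (1 - Q) * norm (y - z)"
        by (rule norm_op_apply_le)
      also have "\<dots> \<le> 1 * norm (y - z)"
        by (intro mult_right_mono norm_contractive_reflection_le contractive_reflection_complement Q) simp
      finally show ?thesis
        by (simp add: dist_norm)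
    qed
    then have "norm (y - op_apply Q y) \<le> infdist y (op_range Q)"
      unfolding infdist_def by (auto simp: op_range_def intro!: cINF_greatest)
    also have "\<dots> \<le> ?\<delta>"
      by (intro infdist_le_gap_delta subspace_op_range y)
    finally show ?thesis .
  qed
  have range: "norm (y - op_apply Q y) \<le> ?\<delta> * norm y" if y: "y \<in> op_range P" for y
  proof (cases "y = 0")
    case False
    then have "norm (y /\<^sub>R norm y - op_apply Q (y /\<^sub>R norm y)) \<le> ?\<delta>"
      by (intro unit) (simp_all add: y subspace_scale[OF subspace_op_range])
    moreover have "y /\<^sub>R norm y - op_apply Q (y /\<^sub>R norm y) = (y - op_apply Q y) /\<^sub>R norm y"
      by (simp add: Q.scaleR scaleR_diff_right)
    ultimately have "norm (y - op_apply Q y) / norm y \<le> ?\<delta>"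
      by (simp add: divide_inverse_commute)
    then show ?thesis
      using False by (simp add: field_simps)
  qed (simp add: Q.zero)
  show ?thesis
  proof (rule norm_operator_le[OF \<delta>])
    fix x
    have "norm (op_apply (P - Q * P) x) \<le> ?\<delta> * norm (op_apply P x)"
      using range[of "op_apply P x"] by (simp add: op_apply_minus op_apply_mult op_range_def)
    also have "norm (op_apply P x) \<le> norm x"
      using norm_op_apply_le[of P x] norm_contractive_reflection_le[OF P]
      by (meson mult_left_le_one_le norm_ge_zero order_trans)
    finally show "norm (op_apply (P - Q * P) x) \<le> ?\<delta> * norm x"
      using \<delta> by (simp add: mult_left_mono)
  qed
qed

lemma gap_op_range_LIMSEQ_iff:
  fixes Q :: "'a::complex_banach operator"
  assumes P: "\<And>n. contractive_reflection (P n)" and Q: "contractive_reflection Q"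
  shows "(\<lambda>n. gap (op_range (P n)) (op_range Q)) \<longlonglongrightarrow> 0 \<longleftrightarrow> P \<longlonglongrightarrow> Q"
proof
  assume gap: "(\<lambda>n. gap (op_range (P n)) (op_range Q)) \<longlonglongrightarrow> 0"
  show "P \<longlonglongrightarrow> Q"
  \<comment> \<open>The two one-sided distances inside \<open>gap\<close> control exactly the two
    hypotheses of the limit criterion.\<close>
  proof (rule contractive_reflection_LIMSEQ[OF P Q])
    show "(\<lambda>n. P n - Q * P n) \<longlonglongrightarrow> 0"
      by (rule Lim_null_comparison[OF always_eventually gap])
        (auto simp: gap_def intro!: max.coboundedI1 norm_diff_mult_le_gap_delta P Q)
    show "(\<lambda>n. Q - P n * Q) \<longlonglongrightarrow> 0"
      by (rule Lim_null_comparison[OF always_eventually gap])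
        (auto simp: gap_def intro!: max.coboundedI2 norm_diff_mult_le_gap_delta P Q)
  qed
next
  assume lim: "P \<longlonglongrightarrow> Q"
  have "norm (gap (op_range (P n)) (op_range Q)) \<le> norm (P n - Q)" for n
  proof -
    have "gap_delta (op_range (P n)) (op_range Q) \<le> norm (P n - Q)"
      "gap_delta (op_range Q) (op_range (P n)) \<le> norm (P n - Q)"
      using gap_delta_op_range_le[OF contractive_reflection_idem[OF P[of n]], of Q]
        gap_delta_op_range_le[OF contractive_reflection_idem[OF Q], of "P n"]
      by (simp_all add: norm_minus_commute)
    moreover have "0 \<le> gap_delta (op_range (P n)) (op_range Q)"
      by (intro gap_delta_nonneg subspace_op_range)
    ultimately show ?thesis
      by (simp add: gap_def)
  qed
  moreover have "(\<lambda>n. norm (P n - Q)) \<longlonglongrightarrow> 0"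
    using lim by (simp add: LIM_zero tendsto_norm_zero)
  ultimately show "(\<lambda>n. gap (op_range (P n)) (op_range Q)) \<longlonglongrightarrow> 0"
    by (rule Lim_null_comparison[OF always_eventually[OF allI]])
qed

section \<open>Moore-Penrose inverses: ranges, null spaces and limits\<close>

lemma op_range_MP_inverse:
  assumes "is_MP_inverse T S"
  shows "op_range S = op_range (S * T)"
proof
  have "op_apply S x = op_apply (S * T) (op_apply S x)" for x
    using assms by (metis is_MP_inverse_def op_apply_mult)
  then show "op_range S \<subseteq> op_range (S * T)"
    by (auto simp: op_range_def)
qed (auto simp: op_range_def op_apply_mult)

text \<open>From \<open>S = S * T * S\<close>, \<open>S\<close> and the idempotent
  \<open>T * S\<close> have the same null space, which is the range of the complement.\<close>

lemma op_null_MP_inverse: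
  fixes T S :: "'a::complex_banach operator"
  assumes "is_MP_inverse T S"
  shows "op_null S = op_range (1 - T * S)"
proof -
  have "op_apply S x = op_apply S (op_apply T (op_apply S x))" for x
    using assms by (metis is_MP_inverse_def op_apply_mult)
  moreover have "op_apply U 0 = 0" for U :: "'a operator"
    using bounded_linear_op_apply by (rule linear_0[OF bounded_linear.linear])
  moreover have "x \<in> op_range (1 - T * S) \<longleftrightarrow> op_apply (T * S) x = 0" for x
    using op_range_idempotent[of "1 - T * S" x] is_MP_inverse_contractive_reflection(1)[OF assms]
    by (simp add: contractive_reflection_idem contractive_reflection_complement op_apply_minus)
  ultimately show ?thesis
    by (auto simp: op_null_def op_apply_mult) metis
qed

text \<open>No bound on \<open>bs\<close> is assumed. The identity for \<open>bs n - b\<close> has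
  \<open>norm (bs n)\<close> on the right only with the small factor \<open>c n\<close>, so
  boundedness follows by absorption.\<close>

lemma MP_inverse_LIMSEQ:
  assumes b: "is_MP_inverse a b" and bs: "\<And>n. is_MP_inverse (as n) (bs n)"
    and as: "as \<longlonglongrightarrow> a"
    and ba: "(\<lambda>n. bs n * as n) \<longlonglongrightarrow> b * a" and ab: "(\<lambda>n. as n * bs n) \<longlonglongrightarrow> a * b"
  shows "bs \<longlonglongrightarrow> b"
proof -
  define c where "c n = norm (a - as n) * norm b + norm (as n * bs n - a * b)" for n
  define d where "d n = norm (b * a - bs n * as n) * norm b" for n
  have "c \<longlonglongrightarrow> norm (a - a) * norm b + norm (a * b - a * b)"
    unfolding c_def by (intro tendsto_intros as ab)
  then have c: "c \<longlonglongrightarrow> 0" by simp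
  have "d \<longlonglongrightarrow> norm (b * a - b * a) * norm b"
    unfolding d_def by (intro tendsto_intros ba)
  then have d: "d \<longlonglongrightarrow> 0" by simp
  have bd: "norm (bs n - b) \<le> norm (bs n) * c n + d n" for n
  proof -
    have e: "bs n * (as n * bs n) = bs n" "b * (a * b) = b"
      using b bs[of n] by (simp_all add: is_MP_inverse_def mult.assoc[symmetric])
    have "bs n - b = bs n * ((a - as n) * b + (as n * bs n - a * b)) - (b * a - bs n * as n) * b"
      by (simp add: algebra_simps e)
    then have "norm (bs n - b) \<le> norm (bs n * ((a - as n) * b + (as n * bs n - a * b)))
        + norm ((b * a - bs n * as n) * b)"
      by (metis norm_triangle_ineq4)
    also have "\<dots> \<le> norm (bs n) * norm ((a - as n) * b + (as n * bs n - a * b)) + d n"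
      unfolding d_def by (intro add_mono norm_mult_ineq)
    also have "\<dots> \<le> norm (bs n) * c n + d n"
      unfolding c_def
      by (intro add_mono mult_left_mono order_trans[OF norm_triangle_ineq] norm_mult_ineq) auto
    finally show ?thesis .
  qed
  \<comment> \<open>With \<open>c n\<close> below \<open>1 / 2\<close>, half of
    \<open>norm (bs n)\<close> can be moved to the left, which bounds it by
    \<open>2 * norm b + 2 * d n\<close>.\<close>
  have "\<forall>\<^sub>F n in sequentially. c n < 1 / 2"
    using c by (rule order_tendstoD) simp
  then have "\<forall>\<^sub>F n in sequentially. norm (bs n - b) \<le> (2 * norm b + 2 * d n) * c n + d n"
  proof eventually_elim
    case (elim n)
    have cn: "0 \<le> c n" by (simp add: c_def)
    have "norm (bs n) \<le> norm b + norm (bs n - b)"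
      by (metis add.commute diff_add_cancel norm_triangle_ineq)
    also have "\<dots> \<le> norm b + (norm (bs n) * (1 / 2) + d n)"
      using bd[of n] mult_left_mono[of "c n" "1 / 2" "norm (bs n)"] elim by simp
    finally have "norm (bs n) \<le> 2 * norm b + 2 * d n" by simp
    with bd[of n] mult_right_mono[OF this cn] show ?case by linarith
  qed
  moreover have "(\<lambda>n. (2 * norm b + 2 * d n) * c n + d n) \<longlonglongrightarrow> (2 * norm b + 2 * 0) * 0 + 0"
    by (intro tendsto_intros c d)
  ultimately have "(\<lambda>n. bs n - b) \<longlonglongrightarrow> 0"
    by (rule Lim_null_comparison[OF _ tendsto_eq_rhs]) simp_all
  then show ?thesis
    by (rule LIM_zero_cancel)
qed

theorem corollary5p9:
  fixes A :: "'a::complex_banach operator"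
    and A_seq :: "nat \<Rightarrow> 'a operator"
  assumes "A \<noteq> 0"
    and "MP_invertible A"
    and "\<And>n. MP_invertible (A_seq n)"
    and "A_seq \<longlonglongrightarrow> A"
  defines "i \<equiv> (\<lambda>n. (A_seq n)\<^sup>\<dagger>) \<longlonglongrightarrow> A\<^sup>\<dagger>"
    and "ii \<equiv> (\<lambda>n. (A_seq n)\<^sup>\<dagger> * A_seq n) \<longlonglongrightarrow> A\<^sup>\<dagger> * A \<and>
               (\<lambda>n. A_seq n * (A_seq n)\<^sup>\<dagger>) \<longlonglongrightarrow> A * A\<^sup>\<dagger>"
    and "iii \<equiv> (\<lambda>n. (A_seq n)\<^sup>\<dagger> * A_seq n) \<longlonglongrightarrow> A\<^sup>\<dagger> * A \<and>
               (\<lambda>n. gap (op_null ((A_seq n)\<^sup>\<dagger>)) (op_null (A\<^sup>\<dagger>))) \<longlonglongrightarrow> 0"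
    and "iv \<equiv> (\<lambda>n. A_seq n * (A_seq n)\<^sup>\<dagger>) \<longlonglongrightarrow> A * A\<^sup>\<dagger> \<and>
               (\<lambda>n. gap (op_range ((A_seq n)\<^sup>\<dagger>)) (op_range (A\<^sup>\<dagger>))) \<longlonglongrightarrow> 0"
    and "v \<equiv> (\<lambda>n. gap (op_range ((A_seq n)\<^sup>\<dagger>)) (op_range (A\<^sup>\<dagger>))) \<longlonglongrightarrow> 0 \<and>
               (\<lambda>n. gap (op_null ((A_seq n)\<^sup>\<dagger>)) (op_null (A\<^sup>\<dagger>))) \<longlonglongrightarrow> 0"
  shows "(i \<longleftrightarrow> ii) \<and> (i \<longleftrightarrow> iii) \<and> (i \<longleftrightarrow> iv) \<and> (i \<longleftrightarrow> v)"
proof -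
  note MP = MP_invertible_is_MP_inverse[OF assms(2)]
  note MP_seq = MP_invertible_is_MP_inverse[OF assms(3)]
  note refl = is_MP_inverse_contractive_reflection[OF MP]
  note refl_seq = is_MP_inverse_contractive_reflection[OF MP_seq]
  have R: "(\<lambda>n. gap (op_range ((A_seq n)\<^sup>\<dagger>)) (op_range (A\<^sup>\<dagger>))) \<longlonglongrightarrow> 0 \<longleftrightarrow>
      (\<lambda>n. (A_seq n)\<^sup>\<dagger> * A_seq n) \<longlonglongrightarrow> A\<^sup>\<dagger> * A"
    unfolding op_range_MP_inverse[OF MP] op_range_MP_inverse[OF MP_seq]
    by (rule gap_op_range_LIMSEQ_iff[OF refl_seq(2) refl(2)])
  have "(\<lambda>n. gap (op_null ((A_seq n)\<^sup>\<dagger>)) (op_null (A\<^sup>\<dagger>))) \<longlonglongrightarrow> 0 \<longleftrightarrow>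
      (\<lambda>n. 1 - A_seq n * (A_seq n)\<^sup>\<dagger>) \<longlonglongrightarrow> 1 - A * A\<^sup>\<dagger>"
    unfolding op_null_MP_inverse[OF MP] op_null_MP_inverse[OF MP_seq]
    by (intro gap_op_range_LIMSEQ_iff contractive_reflection_complement refl_seq refl)
  \<comment> \<open>Subtraction from \<open>1\<close> is a continuous involution, so it serves for
    both directions.\<close>
  also have "\<dots> \<longleftrightarrow> (\<lambda>n. A_seq n * (A_seq n)\<^sup>\<dagger>) \<longlonglongrightarrow> A * A\<^sup>\<dagger>"
    using tendsto_diff[OF tendsto_const[of "1 :: 'a operator"], of "\<lambda>n. 1 - A_seq n * (A_seq n)\<^sup>\<dagger>"]
      tendsto_diff[OF tendsto_const[of "1 :: 'a operator"], of "\<lambda>n. A_seq n * (A_seq n)\<^sup>\<dagger>"]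
    by fastforce
  finally have N: "(\<lambda>n. gap (op_null ((A_seq n)\<^sup>\<dagger>)) (op_null (A\<^sup>\<dagger>))) \<longlonglongrightarrow> 0 \<longleftrightarrow>
      (\<lambda>n. A_seq n * (A_seq n)\<^sup>\<dagger>) \<longlonglongrightarrow> A * A\<^sup>\<dagger>" .
  have "i \<longleftrightarrow> ii"
  proof
    assume i
    then show ii
      unfolding i_def ii_def by (intro conjI tendsto_mult assms(4))
  next
    assume ii
    then show i
      unfolding i_def ii_def using MP_inverse_LIMSEQ[OF MP MP_seq assms(4)] by blast
  qed
  \<comment> \<open>Rewriting with \<open>R\<close> and \<open>N\<close> turns each gap condition
    into one of the two limits in \<open>ii\<close>.\<close>
  moreover have "iii \<longleftrightarrow> ii" "iv \<longleftrightarrow> ii" "v \<longleftrightarrow> ii"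
    unfolding ii_def iii_def iv_def v_def R N by auto
  ultimately show ?thesis
    by blast
qed


end
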